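(* Let $p:\mathbb{R}\to\mathbb{R}$ be a non-affine polynomial. Then there exists a non-polynomial analytic function $\sigma:\mathbb{R}\to\mathbb{R}$ such that for all $d,c,c',w\in\mathbb{N}$ and $k\in\mathbb{N}_0$ (and every compact domain $K\subset\mathbb{R}^{c\times d}$), $$\overline{\Delta^{\sigma,d,2k+1}_{c,c',w}}\subset\overline{\Delta^{p,d,2k+1}_{c,c',w}}.$$
   Context: $\mathbb{N}=\{1,2,\dots\}$, $\mathbb{N}_0=\mathbb{N}\cup\{0\}$. An element $x\in\mathbb{R}^{c\times d}$ is written $x=(x^1,\dots,x^c)$ with channels $x^i=(x^i_1,\dots,x^i_d)\in\mathbb{R}^d$. $\boldsymbol{1}_d\in\mathbb{R}^d$ is the all-ones vector. Zero-padding convolution: for a kernel $v=(v_{-k},\dots,v_k)\in\mathbb{R}^{2k+1}$ and $x\in\mathbb{R}^d$, $v\circledast x\in\mathbb{R}^d$ is given by $(v\circledast x)_i=\sum_{j=-k}^{k}v_jx_{i-j}$ for $1\le i\le d$, with the convention $x_m=0$ for $m\notin\{1,\dots,d\}$. Convolutional layers: $\mathcal{L}^{d,2k+1}_{c_1,c_2}$ is the set of maps $f=(f^1,\dots,f^{c_2}):\mathbb{R}^{c_1\times d}\to\mathbb{R}^{c_2\times d}$ of the form $f^i(x)=\sum_{j=1}^{c_1}v_{i,j}\circledast x^j+\delta_i\boldsymbol{1}_d$ with $v_{i,j}\in\mathbb{R}^{2k+1}$, $\delta_i\in\mathbb{R}$. Deep narrow CNNs: for an activation function $\rho:\mathbb{R}\to\mathbb{R}$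 (applied componentwise), $\Delta^{\rho,d,2k+1}_{c,c',l}$ is the set of all functions $C_N\circ\rho\circ C_{N-1}\circ\cdots\circ\rho\circ C_1:\mathbb{R}^{c\times d}\to\mathbb{R}^{c'\times d}$, where $N\in\mathbb{N}$ is arbitrary, $c_0=c$, $c_N=c'$, $c_1,\dots,c_{N-1}\in\{1,\dots,l\}$ are arbitrary, and $C_i\in\mathcal{L}^{d,2k+1}_{c_{i-1},c_i}$. For a compact $K\subset\mathbb{R}^{c\times d}$ its elements are restricted to $K$, and the overline denotes closure in $C(K,\mathbb{R}^{c'\times d})$ (continuous functions) with respect to the uniform norm $\|f\|_{\infty,K}=\sup_{x\in K}\|f(x)\|_\infty$. *)

theory Defs
  imports "HOL-Analysis.Analysis"
begin

text \<open>
  Channel numbers and lengths vary inside the statement, so an element \<open>x\<close> of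
  $\mathbb{R}^{c\times d}$ is a function on the index set \<open>{1..c} \<times> {1..d}\<close>, extensional (that is,
  equal to \<open>undefined\<close> off the index set), with \<open>x (i, t)\<close> the entry $x^i_t$. Positions \<open>t\<close> are
  integers so that shifted positions need no coercion.
\<close>

type_synonym tensor = "nat \<times> int \<Rightarrow> real"

definition idx :: "nat \<Rightarrow> nat \<Rightarrow> (nat \<times> int) set" where
  "idx c d = {1..c} \<times> {1..int d}"

text \<open>
  \<^const>\<open>funspace\<close> is the metric space of bounded extensional functions with the supremum metric;
  on the finite index set this is $\mathbb{R}^{c\times d}$ with $\|x - y\|_\infty$.
\<close>

definition tensor_metric :: "nat \<Rightarrow> nat \<Rightarrow> tensor metric" where
  "tensor_metric c d = funspace (idx c d) euclidean_metric"

definition conv :: "nat \<Rightarrow> nat \<Rightarrow> (int \<Rightarrow> real) \<Rightarrow> (int \<Rightarrow> real) \<Rightarrow> int \<Rightarrow> real" where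
  "conv d k v x t =
     (\<Sum>j = - int k..int k. v j * (if t - j \<in> {1..int d} then x (t - j) else 0))"

text \<open>
  Maps between spaces of tensors are total HOL functions. They only read the entries of their
  argument inside its index set, and networks are restricted to a domain \<open>K\<close> below. The kernel
  size is \<open>2k+1\<close>.
\<close>

definition conv_layer ::
  "nat \<Rightarrow> nat \<Rightarrow> nat \<Rightarrow> nat \<Rightarrow> (nat \<Rightarrow> nat \<Rightarrow> int \<Rightarrow> real) \<Rightarrow> (nat \<Rightarrow> real) \<Rightarrow> tensor \<Rightarrow> tensor" where
  "conv_layer d k c1 c2 v \<delta> x =
     (\<lambda>(i, t)\<in>idx c2 d. (\<Sum>j = 1..c1. conv d k (v i j) (\<lambda>s. x (j, s)) t) + \<delta> i)"

definition conv_layers :: "nat \<Rightarrow> nat \<Rightarrow> nat \<Rightarrow> nat \<Rightarrow> (tensor \<Rightarrow> tensor) set" where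
  "conv_layers d k c1 c2 = {conv_layer d k c1 c2 v \<delta> | v \<delta>. True}"

definition activation :: "(real \<Rightarrow> real) \<Rightarrow> nat \<Rightarrow> nat \<Rightarrow> tensor \<Rightarrow> tensor" where
  "activation \<rho> c d x = (\<lambda>p\<in>idx c d. \<rho> (x p))"

text \<open>
  \<open>cnn \<rho> d k l c c'\<close> is $\Delta^{\rho,d,2k+1}_{c,c',l}$: the compositions
  $C_N\circ\rho\circ\cdots\circ\rho\circ C_1$, by recursion on $N \geq 1$. Only the hidden
  channel numbers $c_1,\dots,c_{N-1}$ are bounded by \<open>l\<close>; \<open>c\<close> and \<open>c'\<close> are not.
\<close>

inductive is_cnn ::
  "(real \<Rightarrow> real) \<Rightarrow> nat \<Rightarrow> nat \<Rightarrow> nat \<Rightarrow> nat \<Rightarrow> nat \<Rightarrow> (tensor \<Rightarrow> tensor) \<Rightarrow> bool"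
  for \<rho> d k l c where
  single: "C \<in> conv_layers d k c c' \<Longrightarrow> is_cnn \<rho> d k l c c' C"
| compose: "is_cnn \<rho> d k l c m f \<Longrightarrow> m \<in> {1..l} \<Longrightarrow> C \<in> conv_layers d k m c' \<Longrightarrow>
     is_cnn \<rho> d k l c c' (C \<circ> activation \<rho> m d \<circ> f)"

definition cnn ::
  "(real \<Rightarrow> real) \<Rightarrow> nat \<Rightarrow> nat \<Rightarrow> nat \<Rightarrow> nat \<Rightarrow> nat \<Rightarrow> (tensor \<Rightarrow> tensor) set" where
  "cnn \<rho> d k l c c' = {f. is_cnn \<rho> d k l c c' f}"

text \<open>
  $C(K, \mathbb{R}^{c'\times d})$ with the uniform metric. The library's \<^const>\<open>cfunspace\<close> consists of the
  bounded continuous functions; for compact \<open>K\<close> boundedness is automatic.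
\<close>

definition CK :: "nat \<Rightarrow> nat \<Rightarrow> nat \<Rightarrow> tensor set \<Rightarrow> (tensor \<Rightarrow> tensor) metric" where
  "CK d c c' K = cfunspace (subtopology (mtopology_of (tensor_metric c d)) K) (tensor_metric c' d)"

definition cnn_closure ::
  "(real \<Rightarrow> real) \<Rightarrow> nat \<Rightarrow> nat \<Rightarrow> nat \<Rightarrow> nat \<Rightarrow> nat \<Rightarrow> tensor set \<Rightarrow> (tensor \<Rightarrow> tensor) set" where
  "cnn_closure \<rho> d k l c c' K =
     mtopology_of (CK d c c' K) closure_of ((\<lambda>f. restrict f K) ` cnn \<rho> d k l c c')"

definition real_analytic :: "(real \<Rightarrow> real) \<Rightarrow> bool" where
  "real_analytic f \<longleftrightarrow> (\<forall>a. \<exists>F. (\<lambda>h. f (a + h)) has_fps_expansion F)"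

lemma finite_idx [simp]: "finite (idx c d)"
  by (simp add: idx_def)

lemma mspace_tensor_metric: "mspace (tensor_metric c d) = extensional (idx c d)"
  by (auto simp: tensor_metric_def Metric_space.fspace_def Met_TC.Metric_space_axioms
      finite_imp_bounded)

lemma mdist_tensor_metric:
  assumes x: "x \<in> extensional (idx c d)" and y: "y \<in> extensional (idx c d)"
    and "1 \<le> c" "1 \<le> d"
  shows "mdist (tensor_metric c d) x y = (MAX p\<in>idx c d. \<bar>x p - y p\<bar>)"
proof -
  have ne: "idx c d \<noteq> {}"
    using assms by (auto simp: idx_def)
  have m: "x \<in> Met_TC.fspace (idx c d)" "y \<in> Met_TC.fspace (idx c d)"
    using x y mspace_tensor_metric[of c d] by (auto simp: tensor_metric_def)
  have "mdist (tensor_metric c d) x y = (SUP p\<in>idx c d. dist (x p) (y p))"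
    using m ne by (simp add: tensor_metric_def Met_TC.fdist_def)
  also have "\<dots> = (MAX p\<in>idx c d. dist (x p) (y p))"
    using ne by (intro cSup_eq_Max) auto
  finally show ?thesis
    by (simp add: dist_real_def)
qed

lemma cnn_closure_iff:
  assumes K: "compactin (mtopology_of (tensor_metric c d)) K"
    and cont: "\<And>f. f \<in> cnn \<rho> d k l c c' \<Longrightarrow> restrict f K \<in> mspace (CK d c c' K)"
  shows "g \<in> cnn_closure \<rho> d k l c c' K \<longleftrightarrow> g \<in> mspace (CK d c c' K) \<and>
     (\<forall>\<epsilon>>0. \<exists>f\<in>cnn \<rho> d k l c c'. \<forall>x\<in>K. mdist (tensor_metric c' d) (g x) (f x) < \<epsilon>)"
proof -
  let ?X = "subtopology (mtopology_of (tensor_metric c d)) K"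
  have top: "topspace ?X = K"
    using compactin_subset_topspace[OF K] by (auto simp: topspace_subtopology)
  have clo: "g \<in> cnn_closure \<rho> d k l c c' K \<longleftrightarrow> g \<in> mspace (CK d c c' K) \<and>
      (\<forall>\<epsilon>>0. \<exists>f\<in>cnn \<rho> d k l c c'. mdist (CK d c c' K) g (restrict f K) < \<epsilon>)"
    unfolding cnn_closure_def mtopology_of_def
    using cont
    by (auto simp: Metric_space.metric_closure_of[OF Metric_space_mspace_mdist]
        Metric_space.in_mball[OF Metric_space_mspace_mdist])
  have le: "mdist (CK d c c' K) g (restrict f K) \<le> a \<longleftrightarrow>
      (\<forall>x\<in>K. mdist (tensor_metric c' d) (g x) (f x) \<le> a)"
    if "g \<in> mspace (CK d c c' K)" "f \<in> cnn \<rho> d k l c c'" "K \<noteq> {}" for f a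
    using that cont[OF that(2)] top cfunspace_mdist_le[of g ?X "tensor_metric c' d" "restrict f K" a]
    unfolding CK_def by (auto simp del: mspace_cfunspace)
  show ?thesis
  proof (cases "K = {}")
    case True
    have "\<And>f. mdist (CK d c c' K) g (restrict f K) = 0"
      using top True unfolding CK_def
      by (simp add: mdist_cfunspace_eq_mdist_funspace
          Metric_space.fdist_empty[OF Metric_space_mspace_mdist])
    then show ?thesis
      using clo True by simp
  next
    case False
    have "(\<forall>\<epsilon>>0. \<exists>f\<in>cnn \<rho> d k l c c'. mdist (CK d c c' K) g (restrict f K) < \<epsilon>) \<longleftrightarrow>
      (\<forall>\<epsilon>>0. \<exists>f\<in>cnn \<rho> d k l c c'. \<forall>x\<in>K. mdist (tensor_metric c' d) (g x) (f x) < \<epsilon>)"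
      if g: "g \<in> mspace (CK d c c' K)"
    proof (intro iffI allI impI)
      fix \<epsilon> :: real
      assume "\<forall>\<epsilon>>0. \<exists>f\<in>cnn \<rho> d k l c c'. mdist (CK d c c' K) g (restrict f K) < \<epsilon>" "0 < \<epsilon>"
      then obtain f where f: "f \<in> cnn \<rho> d k l c c'" "mdist (CK d c c' K) g (restrict f K) < \<epsilon>"
        by blast
      have "\<forall>x\<in>K. mdist (tensor_metric c' d) (g x) (f x) < \<epsilon>"
        using le[OF g f(1) False, of "mdist (CK d c c' K) g (restrict f K)"] f(2)
        by (meson order_refl order_le_less_trans)
      then show "\<exists>f\<in>cnn \<rho> d k l c c'. \<forall>x\<in>K. mdist (tensor_metric c' d) (g x) (f x) < \<epsilon>"
        using f(1) by blast
    next
      fix \<epsilon> :: real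
      assume *: "\<forall>\<epsilon>>0. \<exists>f\<in>cnn \<rho> d k l c c'. \<forall>x\<in>K. mdist (tensor_metric c' d) (g x) (f x) < \<epsilon>"
        and "0 < \<epsilon>"
      then obtain f where f: "f \<in> cnn \<rho> d k l c c'"
        and "\<forall>x\<in>K. mdist (tensor_metric c' d) (g x) (f x) < \<epsilon> / 2"
        using half_gt_zero by blast
      then have "mdist (CK d c c' K) g (restrict f K) \<le> \<epsilon> / 2"
        using le[OF g f False, of "\<epsilon> / 2"] by (meson less_imp_le)
      then show "\<exists>f\<in>cnn \<rho> d k l c c'. mdist (CK d c c' K) g (restrict f K) < \<epsilon>"
        using f \<open>0 < \<epsilon>\<close> by force
    qed
    then show ?thesis
      using clo by blast
  qed
qed

end

theory Submission
  imports Defs "HOL-Complex_Analysis.Complex_Analysis"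
begin

text \<open>
  Pick \<open>x\<^sub>0\<close> with \<open>p' x\<^sub>0 \<noteq> 0\<close> and normalise \<open>p\<close> affinely to a polynomial \<open>Q x = p (x\<^sub>0 + s x) - p x\<^sub>0\<close>
  with \<open>Q 0 = 0\<close> and \<open>Q' 0 = 2\<close>. The rescaled iterates \<open>Q\<^sup>n (z / 2\<^sup>n)\<close> converge locally uniformly on the
  complex plane to the Poincare function \<open>\<phi>\<close>, an entire solution of \<open>\<phi> (2 z) = Q (\<phi> z)\<close>; comparing
  degrees in this equation shows that \<open>\<phi>\<close> is not a polynomial. Take \<open>\<sigma> x = p (x\<^sub>0 + s \<phi> x)\<close>. Since \<open>p\<close>
  and affine maps can be applied to each channel separately without further channels, every
  \<open>\<sigma>\<close>-network is a uniform limit on compact sets of \<open>p\<close>-networks of the same width. It matters that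
  \<open>\<sigma>\<close> is a limit of functions with \<open>p\<close>, not an affine map, outermost: because of the zero padding, a
  channelwise affine map followed by a convolutional layer need not be a convolutional layer.
\<close>

section \<open>Compositions of locally uniform limits\<close>

text \<open>Since \<open>f'\<close> is bounded on \<open>A\<close>, eventually all
  \<open>f n\<close> map \<open>A\<close> into one fixed ball. There \<open>g n\<close> is uniformly
  close to \<open>g'\<close>, and \<open>g'\<close> is uniformly continuous by compactness, so
  \<open>g' (f n x)\<close> links the two sides.\<close>

lemma uniform_limit_compose_limits:
  fixes f :: "nat \<Rightarrow> 'a \<Rightarrow> 'b::{real_normed_vector, heine_borel}"
    and g :: "nat \<Rightarrow> 'b \<Rightarrow> 'c::metric_space"
  assumes g: "\<And>R. uniform_limit (cball 0 R) g g' sequentially"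
    and cont: "continuous_on UNIV g'"
    and f: "uniform_limit A f f' sequentially" and bdd: "bounded (f' ` A)"
  shows "uniform_limit A (\<lambda>n x. g n (f n x)) (\<lambda>x. g' (f' x)) sequentially"
proof (rule uniform_limitI)
  fix e :: real assume e: "e > 0"
  obtain B where B: "\<And>x. x \<in> A \<Longrightarrow> norm (f' x) \<le> B" using bdd by (auto simp: bounded_iff)
  have "\<forall>\<^sub>F n in sequentially. \<forall>x\<in>A. dist (f n x) (f' x) < 1"
    using uniform_limitD[OF f] by simp
  then have ev: "\<forall>\<^sub>F n in sequentially. \<forall>x\<in>A. f n x \<in> cball 0 (B + 1)"
  proof eventually_elim
    case (elim n)
    show ?case
    proof
      fix x assume "x \<in> A"
      with elim B[of x] norm_triangle_sub[of "f n x" "f' x"] show "f n x \<in> cball 0 (B + 1)"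
        by (fastforce simp: dist_norm)
    qed
  qed
  have "uniformly_continuous_on (cball 0 (B + 1)) g'"
    using cont by (intro compact_uniformly_continuous) (auto intro: continuous_on_subset)
  then have "uniform_limit A (\<lambda>n x. g' (f n x)) (\<lambda>x. g' (f' x)) sequentially"
    using ev by (intro uniform_limit_compose_uniformly_continuous_on[OF f]) auto
  from uniform_limitD[OF this half_gt_zero[OF e]] uniform_limitD[OF g half_gt_zero[OF e], of "B + 1"] ev
  show "\<forall>\<^sub>F n in sequentially. \<forall>x\<in>A. dist (g n (f n x)) (g' (f' x)) < e"
  proof eventually_elim
    case (elim n)
    show ?case
    proof
      fix x assume "x \<in> A"
      with elim have "dist (g' (f n x)) (g' (f' x)) < e / 2" "dist (g n (f n x)) (g' (f n x)) < e / 2"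
        by blast+
      then show "dist (g n (f n x)) (g' (f' x)) < e"
        using dist_triangle[of "g n (f n x)" "g' (f' x)" "g' (f n x)"] by linarith
    qed
  qed
qed

section \<open>Iteration near a repelling fixed point and the Poincare function\<close>

text \<open>
  With \<open>t = |2\<^sup>k u|\<close>, the error bound \<open>2 M t\<^sup>2\<close> reproduces itself: doubling it and adding the new error
  \<open>M (2 t)\<^sup>2\<close> gives \<open>2 M (2 t)\<^sup>2\<close>.
\<close>

lemma norm_funpow_diff_le:
  fixes f :: "complex \<Rightarrow> complex"
  assumes M: "1 \<le> M" and f: "\<And>w. norm w \<le> 1 \<Longrightarrow> norm (f w - 2 * w) \<le> M * (norm w)\<^sup>2"
    and "2 * M * norm (2 ^ k * u) \<le> 1"
  shows "norm ((f ^^ k) u - 2 ^ k * u) \<le> 2 * M * (norm (2 ^ k * u))\<^sup>2"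
  using assms(3)
proof (induction k)
  case 0
  then show ?case using M by simp
next
  case (Suc k)
  define t where "t = norm (2 ^ k * u)"
  define w where "w = (f ^^ k) u"
  have t: "0 \<le> t" by (simp add: t_def)
  have tS: "norm (2 ^ Suc k * u) = 2 * t" by (simp add: t_def norm_mult)
  have small: "4 * M * t \<le> 1" using Suc.prems unfolding tS by simp
  have t4: "4 * t \<le> 1" using small mult_right_mono[OF M t] by linarith
  have IH: "norm (w - 2 ^ k * u) \<le> 2 * M * t\<^sup>2"
    unfolding t_def w_def
  proof (rule Suc.IH)
    show "2 * M * norm (2 ^ k * u) \<le> 1"
      using small mult_nonneg_nonneg[of M t] M t unfolding t_def by linarith
  qed
  also have "\<dots> = (2 * M * t) * t" by (simp add: power2_eq_square)
  also have "\<dots> \<le> 1 * t" using small t M by (intro mult_right_mono) auto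
  finally have w: "norm w \<le> 2 * t"
    using norm_triangle_sub[of w "2 ^ k * u"] by (simp add: t_def)
  have "norm (f w - 2 * w) \<le> M * (norm w)\<^sup>2" using w t4 by (intro f) auto
  also have "\<dots> \<le> M * (2 * t)\<^sup>2" using w M by (intro mult_left_mono power_mono) auto
  finally have 1: "norm (f w - 2 * w) \<le> 4 * M * t\<^sup>2" by (simp add: power_mult_distrib)
  have "norm (f w - 2 ^ Suc k * u) = norm ((f w - 2 * w) + 2 * (w - 2 ^ k * u))"
    by (simp add: algebra_simps)
  also have "\<dots> \<le> norm (f w - 2 * w) + 2 * norm (w - 2 ^ k * u)"
    using norm_triangle_ineq[of "f w - 2 * w" "2 * (w - 2 ^ k * u)"] by (simp only: norm_mult norm_numeral)
  also have "\<dots> \<le> 2 * M * (2 * t)\<^sup>2"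
    using 1 IH by (simp add: power_mult_distrib)
  finally show ?case by (simp only: tS w_def funpow.simps comp_def)
qed

text \<open>For \<open>t \<le> r\<close> the deviation \<open>2 * M * t\<^sup>2\<close> from the
  linear iterate is at most \<open>t\<close>. This keeps orbits in the disc where the polynomial is
  Lipschitz.\<close>

lemma norm_funpow_le:
  fixes f :: "complex \<Rightarrow> complex"
  assumes M: "1 \<le> M" and f: "\<And>w. norm w \<le> 1 \<Longrightarrow> norm (f w - 2 * w) \<le> M * (norm w)\<^sup>2"
    and r: "2 * M * r \<le> 1" and u: "norm (2 ^ k * u) \<le> r"
  shows "norm ((f ^^ k) u) \<le> 2 * r"
proof -
  define t where "t = norm (2 ^ k * u)"
  have t: "0 \<le> t" "t \<le> r" using u by (auto simp: t_def)
  have small: "2 * M * t \<le> 1" using r mult_left_mono[OF t(2), of "2 * M"] M by linarith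
  then have "norm ((f ^^ k) u - 2 ^ k * u) \<le> 2 * M * t\<^sup>2"
    unfolding t_def by (intro norm_funpow_diff_le[OF M f]) auto
  also have "\<dots> = (2 * M * t) * t" by (simp add: power2_eq_square)
  also have "\<dots> \<le> 1 * t" using small t by (intro mult_right_mono) auto
  finally show ?thesis
    using t norm_triangle_sub[of "(f ^^ k) u" "2 ^ k * u"] unfolding t_def by linarith
qed

text \<open>Write \<open>F\<close> as \<open>2 w + w\<^sup>2 G w\<close>; then \<open>M\<close>
  comes from a bound for \<open>G\<close> on the unit disc. The derivative is 2 at 0, hence of
  modulus at most 3 nearby. What matters about 3 is that it lies below
  \<open>2\<^sup>2\<close>.\<close>

lemma poly_local_estimates:
  fixes F :: "complex poly"
  assumes "coeff F 0 = 0" "coeff F 1 = 2"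
  obtains M \<rho> where "1 \<le> M" "\<And>w. norm w \<le> 1 \<Longrightarrow> norm (poly F w - 2 * w) \<le> M * (norm w)\<^sup>2"
    "0 < \<rho>" "\<And>z w. norm z \<le> \<rho> \<Longrightarrow> norm w \<le> \<rho> \<Longrightarrow> norm (poly F z - poly F w) \<le> 3 * norm (z - w)"
proof -
  obtain G where G: "F = pCons 0 (pCons 2 G)"
    using assms by (metis One_nat_def coeff_pCons_0 coeff_pCons_Suc pCons_cases)
  have "compact (poly G ` cball 0 1)"
    by (intro compact_continuous_image continuous_intros) auto
  then have "bounded (poly G ` cball 0 1)" by (rule compact_imp_bounded)
  then obtain B where B: "\<And>w. norm w \<le> 1 \<Longrightarrow> norm (poly G w) \<le> B"
    unfolding bounded_iff by (metis image_eqI mem_cball_0)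
  have 1: "norm (poly F w - 2 * w) \<le> max 1 B * (norm w)\<^sup>2" if "norm w \<le> 1" for w
  proof -
    have "norm (poly F w - 2 * w) = (norm w)\<^sup>2 * norm (poly G w)"
      by (simp add: G algebra_simps norm_mult power2_eq_square)
    also have "\<dots> \<le> (norm w)\<^sup>2 * max 1 B"
      using B[OF that] by (intro mult_left_mono) auto
    finally show ?thesis by (simp add: mult.commute)
  qed
  have d0: "poly (pderiv F) 0 = 2"
    by (simp add: G pderiv_pCons)
  have "isCont (poly (pderiv F)) 0" by (rule poly_isCont)
  then obtain e where e: "e > 0" "\<And>z. dist z 0 < e \<Longrightarrow> dist (poly (pderiv F) z) 2 < 1"
    unfolding continuous_at_eps_delta d0 by (metis zero_less_one)
  have 2: "norm (poly F z - poly F w) \<le> 3 * norm (z - w)"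
    if "norm z \<le> e / 2" "norm w \<le> e / 2" for z w
  proof (rule field_differentiable_bound[where S = "cball 0 (e / 2)" and f' = "poly (pderiv F)"])
    show "(poly F has_field_derivative poly (pderiv F) x) (at x within cball 0 (e / 2))" for x
      by (rule has_field_derivative_at_within[OF poly_DERIV])
    show "norm (poly (pderiv F) x) \<le> 3" if "x \<in> cball 0 (e / 2)" for x
    proof -
      have "dist (poly (pderiv F) x) 2 < 1" using that e by (intro e(2)) auto
      then show ?thesis using norm_triangle_sub[of "poly (pderiv F) x" 2] by (simp add: dist_norm)
    qed
  qed (use that in auto)
  show ?thesis using that[of "max 1 B" "e / 2"] 1 2 e(1) by auto
qed

text \<open>Passing from \<open>h n\<close> to \<open>h (Suc n)\<close> changes the innermost step
  by an error of order \<open>1 / 4 ^ n\<close>, which the \<open>n\<close> outer steps magnify by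
  at most \<open>3 ^ n\<close>. So the differences decay like \<open>(3 / 4) ^ n\<close> on a small
  disc, and the recursion for \<open>h\<close> carries convergence to ever larger discs.\<close>

lemma Poincare_function:
  fixes F :: "complex poly"
  assumes F: "coeff F 0 = 0" "coeff F 1 = 2"
  defines "h \<equiv> \<lambda>n z. (poly F ^^ n) (z / 2 ^ n)"
  obtains \<phi> where "\<phi> holomorphic_on UNIV" "\<And>R. uniform_limit (cball 0 R) h \<phi> sequentially"
    "\<And>z. \<phi> (2 * z) = poly F (\<phi> z)" "\<phi> 0 = 0" "\<exists>x::real. \<phi> (of_real x) \<noteq> 0"
proof -
  obtain M \<rho> where M: "1 \<le> M"
    and quad: "\<And>w. norm w \<le> 1 \<Longrightarrow> norm (poly F w - 2 * w) \<le> M * (norm w)\<^sup>2"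
    and \<rho>: "0 < \<rho>"
    and lip: "\<And>z w. norm z \<le> \<rho> \<Longrightarrow> norm w \<le> \<rho> \<Longrightarrow> norm (poly F z - poly F w) \<le> 3 * norm (z - w)"
    using poly_local_estimates[OF F] by metis
  \<comment> \<open>The bound \<open>\<rho> / 2\<close> keeps the iterates, of norm at most
    \<open>2 * r\<close>, in the Lipschitz disc. The bound \<open>1 / (4 * M)\<close> makes the
    nonlinear error at radius \<open>r\<close> at most \<open>r / 2\<close>, which later yields a
    nonzero value of the limit.\<close>
  define r where "r = min (1 / (4 * M)) (\<rho> / 2)"
  have r: "0 < r" "4 * M * r \<le> 1" "2 * r \<le> \<rho>"
  proof -
    show "0 < r" using M \<rho> by (auto simp: r_def)
    have "4 * M * r \<le> 4 * M * (1 / (4 * M))" using M by (intro mult_left_mono) (auto simp: r_def)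
    then show "4 * M * r \<le> 1" using M by simp
  qed (auto simp: r_def)
  have r2: "2 * M * r \<le> 1" using r(2) mult_nonneg_nonneg[of M r] M r(1) by linarith
  have r1: "r \<le> 1" using r2 M r(1) mult_right_mono[OF M, of r] by linarith
  have step: "norm (h (Suc n) z - h n z) \<le> M * r\<^sup>2 * (3 / 4) ^ n" if z: "norm z \<le> r" for n z
  proof -
    \<comment> \<open>With this \<open>u\<close>, \<open>h (Suc n) z\<close> is the
      \<open>n\<close>-th iterate at \<open>poly F u\<close> and \<open>h n z\<close> the
      \<open>n\<close>-th iterate at \<open>2 * u\<close>, two points that differ only quadratically
      in \<open>u\<close>.\<close>
    define u where "u = z / 2 ^ Suc n"
    have u2: "2 * u = z / 2 ^ n" by (simp add: u_def)
    have pow: "norm (2 ^ j * (z / 2 ^ n)) \<le> r" if "j \<le> n" for j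
    proof -
      have "norm (2 ^ j * (z / 2 ^ n)) = norm z * (2 ^ j / 2 ^ n)"
        by (simp add: norm_mult norm_divide norm_power)
      also have "\<dots> \<le> norm z * 1"
        using that by (intro mult_left_mono) (auto simp: divide_le_eq power_increasing)
      finally show ?thesis using z by simp
    qed
    have "norm ((poly F ^^ j) (poly F u) - (poly F ^^ j) (2 * u)) \<le> 3 ^ j * norm (poly F u - 2 * u)"
      if "j \<le> n" for j
      using that
    proof (induction j)
      case (Suc j)
      \<comment> \<open>The first orbit is read as \<open>Suc j\<close> iterations from
        \<open>u\<close>, because \<open>2 ^ Suc j * u\<close> is
        \<open>2 ^ j * (z / 2 ^ n)\<close>.\<close>
      have "norm ((poly F ^^ Suc j) u) \<le> 2 * r"
      proof (rule norm_funpow_le[OF M quad r2])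
        show "norm (2 ^ Suc j * u) \<le> r"
          using pow[of j] Suc.prems by (simp add: mult_ac flip: u2)
      qed
      then have a: "norm ((poly F ^^ j) (poly F u)) \<le> 2 * r" by (simp add: funpow_swap1)
      have b: "norm ((poly F ^^ j) (2 * u)) \<le> 2 * r"
        using pow[of j] Suc.prems unfolding u2 by (intro norm_funpow_le[OF M quad r2]) auto
      have "norm ((poly F ^^ Suc j) (poly F u) - (poly F ^^ Suc j) (2 * u))
          \<le> 3 * norm ((poly F ^^ j) (poly F u) - (poly F ^^ j) (2 * u))"
        using a b r(3) lip[of "(poly F ^^ j) (poly F u)" "(poly F ^^ j) (2 * u)"] by simp
      with Suc show ?case by simp
    qed simp
    from this[of n] have "norm (h (Suc n) z - h n z) \<le> 3 ^ n * norm (poly F u - 2 * u)"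
      by (simp add: h_def funpow_swap1 u2) (simp add: u_def)
    also have "\<dots> \<le> 3 ^ n * (M * (norm u)\<^sup>2)"
    proof (intro mult_left_mono quad)
      have "norm u \<le> norm z" 
        using power_increasing[of 0 "Suc n" "2::real"]
        by (simp add: u_def norm_divide norm_mult norm_power divide_le_eq mult_le_cancel_left1)
      then show "norm u \<le> 1" using z r1 by simp
    qed auto
    also have "norm u = norm z / 2 ^ Suc n"
      by (simp add: u_def norm_divide norm_mult norm_power)
    also have "3 ^ n * (M * (norm z / 2 ^ Suc n)\<^sup>2) = M * (norm z)\<^sup>2 * (3 / 4) ^ n / 4"
    proof -
      have "(2 ^ Suc n)\<^sup>2 = 4 * (4::real) ^ n"
        by (simp add: power_mult[symmetric] power2_eq_square flip: power_mult_distrib)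
      then show ?thesis by (simp add: power_divide mult_ac)
    qed
    also have "\<dots> \<le> M * r\<^sup>2 * (3 / 4) ^ n / 1"
      using z M by (intro frac_le mult_right_mono mult_left_mono power_mono) auto
    finally show ?thesis by simp
  qed
  have conv0: "uniformly_convergent_on (cball 0 r) h"
  proof -
    have "uniformly_convergent_on (cball 0 r) (\<lambda>n z. \<Sum>i<n. h (Suc i) z - h i z)"
      using step by (intro Weierstrass_m_test'[where M = "\<lambda>n. M * r\<^sup>2 * (3 / 4) ^ n"]
          summable_mult summable_geometric) auto
    also have "(\<lambda>n z. \<Sum>i<n. h (Suc i) z - h i z) = (\<lambda>n z. h n z - h 0 z)"
      by (intro ext sum_lessThan_telescope)
    finally have "uniformly_convergent_on (cball 0 r) (\<lambda>n z. h n z - h 0 z)" .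
    then have "uniformly_convergent_on (cball 0 r) (\<lambda>n z. (h n z - h 0 z) + h 0 z)"
      by (rule uniformly_convergent_add) auto
    then show ?thesis by simp
  qed
  have hS: "h (Suc n) z = poly F (h n (z / 2))" for n z
    by (simp add: h_def)
  \<comment> \<open>Each induction step doubles the radius: \<open>h (Suc n)\<close> on the larger
    disc is \<open>poly F\<close> after \<open>h n\<close> on the disc of half the size.\<close>
  have conv: "uniformly_convergent_on (cball 0 (2 ^ m * r)) h" for m
  proof (induction m)
    case (Suc m)
    define A :: "complex set" where "A = cball 0 (2 ^ m * r)"
    obtain g where g: "uniform_limit A h g sequentially"
      using Suc unfolding A_def uniformly_convergent_on_def by blast
    have "continuous_on A (h n)" for n
    proof -
      have "continuous_on UNIV (poly F ^^ n)"
        by (induction n) (auto intro!: continuous_intros)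
      from continuous_on_subset[OF this subset_UNIV, of "(\<lambda>z. z / 2 ^ n) ` A"] show ?thesis
        unfolding h_def by (rule continuous_on_compose2) (auto intro!: continuous_intros)
    qed
    then have "continuous_on A g"
      using g by (intro uniform_limit_theorem[OF _ g]) auto
    then have "bounded (g ` A)"
      by (intro compact_imp_bounded compact_continuous_image) (auto simp: A_def)
    moreover have "continuous_on UNIV (poly F)" by (intro continuous_intros)
    ultimately have "uniform_limit A (\<lambda>n z. poly F (h n z)) (\<lambda>z. poly F (g z)) sequentially"
      by (intro uniform_limit_compose_limits[OF uniform_limit_const _ g])
    then have "uniform_limit (cball 0 (2 ^ Suc m * r)) (\<lambda>n z. poly F (h n (z / 2)))
        (\<lambda>z. poly F (g (z / 2))) sequentially"
      by (rule uniform_limit_compose') (auto simp: A_def norm_divide)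
    then have "uniform_limit (cball 0 (2 ^ Suc m * r)) h (\<lambda>z. poly F (g (z / 2))) sequentially"
      unfolding hS[symmetric] filterlim_sequentially_Suc .
    then show ?case unfolding uniformly_convergent_on_def by blast
  qed (use conv0 in simp)
  \<comment> \<open>A single pointwise limit serves all discs, so the uniform limits on them
    agree.\<close>
  define \<phi> where "\<phi> z = lim (\<lambda>n. h n z)" for z
  have lim: "uniform_limit (cball 0 R) h \<phi> sequentially" for R
  proof -
    obtain m where "R / r < 2 ^ m" using real_arch_pow[of 2 "R / r"] by auto
    then have "cball 0 R \<subseteq> cball (0::complex) (2 ^ m * r)"
      using r(1) by (auto simp: field_simps)
    then show ?thesis
      using conv[of m] uniform_limit_on_subset
      unfolding uniformly_convergent_uniform_limit_iff \<phi>_def by blast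
  qed
  have pt: "(\<lambda>n. h n z) \<longlonglongrightarrow> \<phi> z" for z
    using tendsto_uniform_limitI[OF lim[of "norm z"], of z] by simp
  have hol: "\<phi> holomorphic_on UNIV"
  proof (rule holomorphic_uniform_sequence)
    show "h n holomorphic_on UNIV" for n
    proof -
      have "(poly F ^^ n) holomorphic_on UNIV"
        by (induction n) (auto intro!: holomorphic_intros holomorphic_on_compose)
      then have "(poly F ^^ n) \<circ> (\<lambda>z. z / 2 ^ n) holomorphic_on UNIV"
        by (intro holomorphic_on_compose holomorphic_intros) (auto intro: holomorphic_on_subset)
      then show ?thesis by (simp add: h_def comp_def)
    qed
    show "\<exists>d>0. cball z d \<subseteq> UNIV \<and> uniform_limit (cball z d) h \<phi> sequentially" for z :: complex
      by (rule exI[of _ 1], auto intro!: uniform_limit_on_subset[OF lim[of "norm z + 1"]])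
        (smt (verit) dist_norm norm_minus_commute norm_triangle_sub)
  qed auto
  have fe: "\<phi> (2 * z) = poly F (\<phi> z)" for z
  proof (rule LIMSEQ_unique)
    show "(\<lambda>n. h (Suc n) (2 * z)) \<longlonglongrightarrow> \<phi> (2 * z)" using LIMSEQ_Suc[OF pt] .
    show "(\<lambda>n. h (Suc n) (2 * z)) \<longlonglongrightarrow> poly F (\<phi> z)" unfolding hS
      using pt[of z] by (auto intro!: tendsto_intros)
  qed
  have h0: "h n 0 = 0" for n
    using F by (induction n) (auto simp: hS poly_0_coeff_0, simp add: h_def)
  have "\<phi> 0 = 0" using pt[of 0] by (simp add: h0 LIMSEQ_const_iff)
  \<comment> \<open>\<open>h n r\<close> stays within \<open>2 * M * r\<^sup>2 \<le> r / 2\<close>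
    of \<open>r\<close>. This excludes the zero function, which also solves the functional
    equation.\<close>
  moreover have "\<phi> (of_real r) \<noteq> 0"
  proof
    assume "\<phi> (of_real r) = 0"
    then have 0: "(\<lambda>n. norm (h n (of_real r) - of_real r)) \<longlonglongrightarrow> norm (0 - complex_of_real r)"
      using pt[of "of_real r"] by (intro tendsto_intros) auto
    have "norm (h n (of_real r) - of_real r) \<le> 2 * M * r\<^sup>2" for n
      using norm_funpow_diff_le[OF M quad, of n "of_real r / 2 ^ n"] r r2 by (simp add: h_def)
    then have "norm (0 - complex_of_real r) \<le> 2 * M * r\<^sup>2"
      by (intro LIMSEQ_le_const2[OF 0]) auto
    moreover have "4 * M * r * r \<le> 1 * r" using r by (intro mult_right_mono) auto
    ultimately show False using r(1) by (simp add: power2_eq_square)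
  qed
  ultimately show ?thesis using that[OF hol lim fe] by blast
qed

section \<open>Real analyticity from an entire extension\<close>

text \<open>The Taylor series of \<open>f\<close> at a real point converges everywhere. As
  \<open>g\<close> is real, the real parts of the coefficients form a power series with sum
  \<open>g (a + x)\<close>.\<close>

lemma real_analytic_of_holomorphic:
  fixes g :: "real \<Rightarrow> real"
  assumes hol: "f holomorphic_on UNIV" and f: "\<And>x. f (of_real x) = of_real (g x)"
  shows "real_analytic g"
  unfolding real_analytic_def
proof
  fix a :: real
  define c where "c n = (deriv ^^ n) f (of_real a) / fact n" for n
  have c: "(\<lambda>n. Re (c n) * x ^ n) sums g (a + x)" for x
  proof -
    have "(\<lambda>n. c n * (of_real (a + x) - of_real a) ^ n) sums f (of_real (a + x))"
      unfolding c_def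
      by (rule holomorphic_power_series[where r = "\<bar>x\<bar> + 1"])
        (auto intro: holomorphic_on_subset[OF hol] simp: dist_norm)
    then have "(\<lambda>n. c n * of_real (x ^ n)) sums of_real (g (a + x))"
      unfolding of_real_diff[symmetric] of_real_power[symmetric] f by simp
    from sums_Re[OF this] show ?thesis by simp
  qed
  have "fps_conv_radius (Abs_fps (\<lambda>n. Re (c n))) \<ge> \<infinity>"
    unfolding fps_conv_radius_def
    using c by (intro conv_radius_geI_ex') (auto simp: sums_iff)
  then have "(\<lambda>h. g (a + h)) has_fps_expansion Abs_fps (\<lambda>n. Re (c n))"
    using c by (auto simp: has_fps_expansion_def eval_fps_def sums_iff)
  then show "\<exists>F. (\<lambda>h. g (a + h)) has_fps_expansion F" ..
qed

section \<open>Networks and channelwise maps\<close>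

text \<open>These are the functions that a network can apply to each entry without mixing channels
  or positions. Being affine at the outer end, they can be followed by an activation.\<close>

inductive affine_iterate :: "(real \<Rightarrow> real) \<Rightarrow> (real \<Rightarrow> real) \<Rightarrow> bool" for \<rho> where
  affine: "affine_iterate \<rho> (\<lambda>x. a * x + b)"
| step: "affine_iterate \<rho> h \<Longrightarrow> affine_iterate \<rho> (\<lambda>x. a * \<rho> (h x) + b)"

lemma activation_activation:
  "activation g c d (activation h c d x) = activation (\<lambda>y. g (h y)) c d x"
  by (auto simp: activation_def)

lemma conv_layer_apply:
  "(i, t) \<in> idx c2 d \<Longrightarrow> conv_layer d k c1 c2 v \<delta> x (i, t) =
     (\<Sum>j = 1..c1. \<Sum>s = - int k..int k.
        v i j s * (if t - s \<in> {1..int d} then x (j, t - s) else 0)) + \<delta> i"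
  by (simp add: conv_layer_def conv_def)

text \<open>Zero padding acts on the input of the convolution, so an affine map applied afterwards
  only changes kernels and biases.\<close>

lemma activation_affine_conv_layer:
  "activation (\<lambda>y. a * y + b) c2 d (conv_layer d k c1 c2 v \<delta> x) =
     conv_layer d k c1 c2 (\<lambda>i j s. a * v i j s) (\<lambda>i. a * \<delta> i + b) x"
  by (rule ext) (auto simp: activation_def conv_layer_def conv_def restrict_def
      sum_distrib_left algebra_simps)

text \<open>A kernel supported at offset 0 never reads the padding, so channelwise affine maps are
  layers for every \<open>k\<close>, without additional channels.\<close>

lemma conv_layer_diagonal:
  "conv_layer d k c c (\<lambda>i j s. if i = j \<and> s = 0 then a else 0) (\<lambda>_. b) x =
     activation (\<lambda>y. a * y + b) c d x"
proof
  fix q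
  show "conv_layer d k c c (\<lambda>i j s. if i = j \<and> s = 0 then a else 0) (\<lambda>_. b) x q =
     activation (\<lambda>y. a * y + b) c d x q"
  proof (cases "q \<in> idx c d")
    case True
    then obtain i t where q: "q = (i, t)" "i \<in> {1..c}" "t \<in> {1..int d}" by (auto simp: idx_def)
    have "(\<Sum>s = - int k..int k. (if i = j \<and> s = 0 then a else 0) *
        (if t - s \<in> {1..int d} then x (j, t - s) else 0)) = (if j = i then a * x (j, t) else 0)" for j
    proof -
      have "(\<Sum>s = - int k..int k. (if i = j \<and> s = 0 then a else 0) *
          (if t - s \<in> {1..int d} then x (j, t - s) else 0)) =
        (\<Sum>s = - int k..int k. if s = 0 then if j = i then a * x (j, t) else 0 else 0)"
        using q by (intro sum.cong) auto
      then show ?thesis by (simp add: sum.delta)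
    qed
    then show ?thesis using True q by (simp add: conv_layer_apply activation_def sum.delta)
  qed (simp add: conv_layer_def activation_def)
qed

text \<open>The affine map is absorbed into the last layer.\<close>

lemma is_cnn_activation_affine:
  assumes "is_cnn \<rho> d k l c c' f"
  shows "is_cnn \<rho> d k l c c' (activation (\<lambda>y. a * y + b) c' d \<circ> f)"
proof -
  have layer: "activation (\<lambda>y. a * y + b) c' d \<circ> C \<in> conv_layers d k m c'"
    if "C \<in> conv_layers d k m c'" for m C
    using that by (fastforce simp: conv_layers_def comp_def activation_affine_conv_layer)
  from assms show ?thesis
  proof cases
    case single
    then show ?thesis using layer is_cnn.single by blast
  next
    case (compose m g C)
    then show ?thesis using is_cnn.compose[OF compose(2,3) layer[OF compose(4)]]
      by (simp add: comp_assoc)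
  qed
qed

text \<open>Each application of \<open>\<rho>\<close> is an activation on the \<open>m\<close>
  channels already present, followed by a diagonal layer. Depth grows, width does not.\<close>

lemma is_cnn_affine_iterate:
  assumes "affine_iterate \<rho> h" "is_cnn \<rho> d k l c m f" "m \<in> {1..l}"
  shows "is_cnn \<rho> d k l c m (activation h m d \<circ> f)"
  using assms(1)
proof induction
  case (affine a b)
  then show ?case using is_cnn_activation_affine[OF assms(2)] .
next
  case (step h a b)
  have "(\<lambda>x. activation (\<lambda>y. a * y + b) m d x) \<in> conv_layers d k m m"
    unfolding conv_layers_def conv_layer_diagonal[symmetric, where k = k] by blast
  from is_cnn.compose[OF step.IH assms(3) this] show ?case
    by (simp add: comp_def activation_activation)
qed

lemma is_cnn_extensional:
  assumes "is_cnn \<rho> d k l c c' f"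
  shows "f x \<in> extensional (idx c' d)"
  using assms by cases (auto simp: conv_layers_def conv_layer_def)

section \<open>Continuity and approximation of networks\<close>

text \<open>An arbitrary topology \<open>X\<close> with continuous coordinates covers both the whole
  tensor space and its subspace \<open>K\<close>.\<close>

lemma continuous_map_is_cnn:
  assumes "continuous_on UNIV \<rho>"
    and "\<And>q. q \<in> idx c d \<Longrightarrow> continuous_map X euclideanreal (\<lambda>x. x q)"
    and "is_cnn \<rho> d k l c c' f" "q \<in> idx c' d"
  shows "continuous_map X euclideanreal (\<lambda>x. f x q)"
proof -
  have layer: "continuous_map X euclideanreal (\<lambda>x. C (g x) q)"
    if C: "C \<in> conv_layers d k m c'" and q': "q \<in> idx c' d"
      and g: "\<And>q. q \<in> idx m d \<Longrightarrow> continuous_map X euclideanreal (\<lambda>x. g x q)" for C m c' g q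
  proof -
    obtain v \<delta> where C: "C = conv_layer d k m c' v \<delta>"
      using C by (auto simp: conv_layers_def)
    obtain i t where q: "q = (i, t)" by force
    \<comment> \<open>Whether an entry is padding depends on its position alone, so each entry is a
      coordinate or the constant 0.\<close>
    have "continuous_map X euclideanreal (\<lambda>x. if t - s \<in> {1..int d} then g x (j, t - s) else 0)"
      if "j \<in> {1..m}" for s j
      using that(1) by (cases "t - s \<in> {1..int d}") (auto simp: idx_def intro!: g)
    then show ?thesis
      using q' unfolding C q
      by (simp only: conv_layer_apply)
        (intro continuous_map_add continuous_map_sum continuous_map_real_mult continuous_map_const[THEN iffD2]; simp)
  qed
  from assms(3,4) show ?thesis
  proof (induction arbitrary: q)
    case (single C c')
    then show ?case using layer[of C c c' q "\<lambda>x. x"] assms(2) by simp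
  next
    case (compose m f C c')
    have "continuous_map X euclideanreal (\<lambda>x. activation \<rho> m d (f x) q)" if "q \<in> idx m d" for q
    proof -
      have "continuous_map X euclideanreal (\<rho> \<circ> (\<lambda>x. f x q))"
        using compose.IH[OF that] assms(1) by (intro continuous_map_compose) auto
      with that show ?thesis by (simp add: activation_def comp_def)
    qed
    then show ?case
      using layer[OF compose(3) compose.prems] by simp
  qed
qed

lemma uniform_limit_sum:
  fixes f :: "'i \<Rightarrow> 'n \<Rightarrow> 'a \<Rightarrow> 'b::real_normed_vector"
  assumes "\<And>i. i \<in> I \<Longrightarrow> uniform_limit A (f i) (g i) F"
  shows "uniform_limit A (\<lambda>n x. \<Sum>i\<in>I. f i n x) (\<lambda>x. \<Sum>i\<in>I. g i x) F"
  using assms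
  by (induction I rule: infinite_finite_induct) (auto intro!: uniform_limit_intros)

lemma uniform_limit_conv_layer:
  assumes "C \<in> conv_layers d k c1 c2" "q \<in> idx c2 d"
    and g: "\<And>q. q \<in> idx c1 d \<Longrightarrow> uniform_limit K (\<lambda>n x. g n x q) (\<lambda>x. g' x q) sequentially"
  shows "uniform_limit K (\<lambda>n x. C (g n x) q) (\<lambda>x. C (g' x) q) sequentially"
proof -
  obtain v \<delta> where C: "C = conv_layer d k c1 c2 v \<delta>"
    using assms(1) by (auto simp: conv_layers_def)
  obtain i t where q: "q = (i, t)" by force
  have "uniform_limit K (\<lambda>n x. if t - s \<in> {1..int d} then g n x (j, t - s) else 0)
      (\<lambda>x. if t - s \<in> {1..int d} then g' x (j, t - s) else 0) sequentially"
    if "j \<in> {1..c1}" for s j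
    using that by (cases "t - s \<in> {1..int d}") (auto simp: idx_def intro!: g uniform_limit_const)
  then show ?thesis
    using assms(2) unfolding C q
    by (simp only: conv_layer_apply) (intro uniform_limit_intros uniform_limit_sum; simp)
qed

text \<open>Each hidden \<open>\<sigma>\<close> is replaced by \<open>\<rho>\<close> after
  \<open>h n\<close>, realised at the same width. Errors of earlier layers are harmless because the
  exact values on the compact \<open>K\<close> are bounded, so the uniform limits compose.\<close>

lemma is_cnn_approximation:
  assumes f: "is_cnn \<sigma> d k l c c' f"
    and cont: "continuous_on UNIV \<sigma>"
    and h: "\<And>n. affine_iterate \<rho> (h n)"
    and lim: "\<And>R. uniform_limit (cball 0 R) (\<lambda>n x. \<rho> (h n x)) \<sigma> sequentially"
    and K: "compactin X K" "\<And>q. q \<in> idx c d \<Longrightarrow> continuous_map X euclideanreal (\<lambda>x. x q)"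
  shows "\<exists>fs. (\<forall>n. is_cnn \<rho> d k l c c' (fs n)) \<and>
    (\<forall>q\<in>idx c' d. uniform_limit K (\<lambda>n x. fs n x q) (\<lambda>x. f x q) sequentially)"
  using f
proof induction
  case (single C c')
  then show ?case
    by (intro exI[of _ "\<lambda>_. C"]) (auto intro: is_cnn.single uniform_limit_const)
next
  case (compose m f C c')
  then obtain fs where fs: "\<And>n. is_cnn \<rho> d k l c m (fs n)"
    and lim_fs: "\<And>q. q \<in> idx m d \<Longrightarrow> uniform_limit K (\<lambda>n x. fs n x q) (\<lambda>x. f x q) sequentially"
    by blast
  \<comment> \<open>The activation of the composition supplies the outermost \<open>\<rho>\<close>
    of \<open>\<rho> (h n x)\<close>, so \<open>C\<close> directly follows an activation and is kept
    unchanged.\<close>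
  define gs where "gs n = C \<circ> activation \<rho> m d \<circ> (activation (h n) m d \<circ> fs n)" for n
  have gs: "is_cnn \<rho> d k l c c' (gs n)" for n
    unfolding gs_def using compose.hyps
    by (intro is_cnn.compose is_cnn_affine_iterate[OF h fs])
  have "uniform_limit K (\<lambda>n x. gs n x q) (\<lambda>x. (C \<circ> activation \<sigma> m d \<circ> f) x q) sequentially"
    if q: "q \<in> idx c' d" for q
    unfolding gs_def comp_def
  proof (rule uniform_limit_conv_layer[OF compose.hyps(3) q])
    fix q assume q: "q \<in> idx m d"
    have "compactin euclideanreal ((\<lambda>x. f x q) ` K)"
      using continuous_map_is_cnn[OF cont K(2) compose.hyps(1) q] K(1) image_compactin by blast
    then have "bounded ((\<lambda>x. f x q) ` K)" by (simp add: compact_imp_bounded)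
    from uniform_limit_compose_limits[OF lim cont lim_fs[OF q] this] q
    show "uniform_limit K (\<lambda>n x. activation \<rho> m d (activation (h n) m d (fs n x)) q)
        (\<lambda>x. activation \<sigma> m d (f x) q) sequentially"
      by (simp add: activation_activation activation_def)
  qed
  with gs show ?case by blast
qed

section \<open>Tensor spaces and closures\<close>

lemma continuous_map_tensor_component:
  assumes "1 \<le> c" "1 \<le> d" "q \<in> idx c d"
  shows "continuous_map (mtopology_of (tensor_metric c d)) euclideanreal (\<lambda>x. x q)"
proof -
  have "mdist euclidean_metric (x q) (y q) \<le> 1 * mdist (tensor_metric c d) x y"
    if "x \<in> extensional (idx c d)" "y \<in> extensional (idx c d)" for x y
    using assms that by (simp add: mdist_tensor_metric dist_real_def Max_ge)
  then have "Lipschitz_continuous_map (tensor_metric c d) euclidean_metric (\<lambda>x. x q)"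
    unfolding Lipschitz_continuous_map_def mspace_tensor_metric by (auto intro: exI[of _ 1])
  then show ?thesis
    using Lipschitz_continuous_imp_continuous_map mtopology_of_euclidean by metis
qed

lemma continuous_map_tensorI:
  assumes "1 \<le> c" "1 \<le> d" "\<And>x. f x \<in> extensional (idx c d)"
    and f: "\<And>q. q \<in> idx c d \<Longrightarrow> continuous_map X euclideanreal (\<lambda>x. f x q)"
  shows "continuous_map X (mtopology_of (tensor_metric c d)) f"
proof -
  interpret M: Metric_space "mspace (tensor_metric c d)" "mdist (tensor_metric c d)"
    by (rule Metric_space_mspace_mdist)
  have ne: "idx c d \<noteq> {}" using assms by (auto simp: idx_def)
  show ?thesis
    unfolding mtopology_of_def M.continuous_map_to_metric
  proof (intro ballI allI impI)
    fix x and e :: real assume x: "x \<in> topspace X" and e: "e > 0"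
    define U where "U q = {y \<in> topspace X. f y q \<in> ball (f x q) e}" for q
    have "openin X (U q)" if "q \<in> idx c d" for q
      unfolding U_def using f[OF that] by (rule openin_continuous_map_preimage) auto
    then have "openin X (\<Inter>q\<in>idx c d. U q)" using ne by (intro openin_Inter) auto
    moreover have "x \<in> (\<Inter>q\<in>idx c d. U q)" using x e by (auto simp: U_def)
    moreover have "f y \<in> M.mball (f x) e" if "y \<in> (\<Inter>q\<in>idx c d. U q)" for y
      using that assms(1-3) ne unfolding M.in_mball
      by (auto simp: mspace_tensor_metric mdist_tensor_metric U_def dist_real_def)
    ultimately show "\<exists>U. openin X U \<and> x \<in> U \<and> (\<forall>y\<in>U. f y \<in> M.mball (f x) e)" by blast
  qed
qed

text \<open>This supplies the membership premise of \<open>cnn_closure_iff\<close>; boundedness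
  comes from compactness of the image of \<open>K\<close>.\<close>

lemma restrict_cnn_in_CK:
  assumes "1 \<le> d" "1 \<le> c" "1 \<le> c'" "continuous_on UNIV \<rho>"
    and K: "compactin (mtopology_of (tensor_metric c d)) K"
    and f: "f \<in> cnn \<rho> d k l c c'"
  shows "restrict f K \<in> mspace (CK d c c' K)"
proof -
  let ?X = "subtopology (mtopology_of (tensor_metric c d)) K"
  have top: "topspace ?X = K"
    using compactin_subset_topspace[OF K] by (auto simp: topspace_subtopology)
  have f': "is_cnn \<rho> d k l c c' f" using f by (simp add: cnn_def)
  have cont: "continuous_map ?X (mtopology_of (tensor_metric c' d)) f"
    using assms
    by (intro continuous_map_tensorI is_cnn_extensional[OF f'] continuous_map_is_cnn[OF assms(4) _ f']
        continuous_map_from_subtopology continuous_map_tensor_component)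
  then have cont': "continuous_map ?X (mtopology_of (tensor_metric c' d)) (restrict f K)"
    by (rule continuous_map_eq) (simp add: top)
  have "compactin ?X K" using K by (simp add: compactin_subtopology)
  from image_compactin[OF this cont']
  have "Metric_space.mbounded (mspace (tensor_metric c' d)) (mdist (tensor_metric c' d)) (restrict f K ` K)"
    by (intro Metric_space.compactin_imp_mbounded[OF Metric_space_mspace_mdist])
      (simp add: mtopology_of_def)
  with cont' show ?thesis
    unfolding CK_def mspace_cfunspace top
    using is_cnn_extensional[OF f'] by (auto simp: mspace_tensor_metric)
qed

text \<open>Half of the error is spent on a \<open>\<sigma>\<close>-network near \<open>g\<close>,
  the other half on a \<open>\<rho>\<close>-network near that network.\<close>

lemma cnn_closure_subset:
  assumes "1 \<le> d" "1 \<le> c" "1 \<le> c'"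
    and \<sigma>: "continuous_on UNIV \<sigma>" and \<rho>: "continuous_on UNIV \<rho>"
    and h: "\<And>n. affine_iterate \<rho> (h n)"
    and lim: "\<And>R. uniform_limit (cball 0 R) (\<lambda>n x. \<rho> (h n x)) \<sigma> sequentially"
    and K: "compactin (mtopology_of (tensor_metric c d)) K"
  shows "cnn_closure \<sigma> d k l c c' K \<subseteq> cnn_closure \<rho> d k l c c' K"
proof
  let ?m = "mdist (tensor_metric c' d)"
  fix g assume "g \<in> cnn_closure \<sigma> d k l c c' K"
  then have g: "g \<in> mspace (CK d c c' K)"
    and app: "\<And>e. e > 0 \<Longrightarrow> \<exists>f\<in>cnn \<sigma> d k l c c'. \<forall>x\<in>K. ?m (g x) (f x) < e"
    using cnn_closure_iff[OF K restrict_cnn_in_CK[OF assms(1-3) \<sigma> K]] by auto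
  have gx: "g x \<in> mspace (tensor_metric c' d)" if "x \<in> K" for x
    using g that compactin_subset_topspace[OF K]
    unfolding CK_def mspace_cfunspace by (auto simp: topspace_subtopology)
  have ne: "idx c' d \<noteq> {}" using assms by (auto simp: idx_def)
  have "\<exists>f\<in>cnn \<rho> d k l c c'. \<forall>x\<in>K. ?m (g x) (f x) < e" if e: "e > 0" for e
  proof -
    obtain f where f: "is_cnn \<sigma> d k l c c' f" and gf: "\<And>x. x \<in> K \<Longrightarrow> ?m (g x) (f x) < e / 2"
      using app[of "e / 2"] e by (auto simp: cnn_def)
    obtain fs where fs: "\<And>n. is_cnn \<rho> d k l c c' (fs n)"
      and "\<forall>q\<in>idx c' d. uniform_limit K (\<lambda>n x. fs n x q) (\<lambda>x. f x q) sequentially"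
      using is_cnn_approximation[OF f \<sigma> h lim K continuous_map_tensor_component[OF assms(2,1)]]
      by blast
    \<comment> \<open>There are finitely many coordinates, so one \<open>n\<close> works for all of
      them.\<close>
    then have "\<forall>\<^sub>F n in sequentially. \<forall>q\<in>idx c' d. \<forall>x\<in>K. dist (fs n x q) (f x q) < e / 2"
      using e by (intro eventually_ball_finite[OF finite_idx] ballI uniform_limitD) auto
    then obtain n where n: "\<And>q x. q \<in> idx c' d \<Longrightarrow> x \<in> K \<Longrightarrow> dist (fs n x q) (f x q) < e / 2"
      by (auto simp: eventually_sequentially)
    have "?m (g x) (fs n x) < e" if "x \<in> K" for x
    proof -
      have "?m (f x) (fs n x) = (MAX q\<in>idx c' d. \<bar>f x q - fs n x q\<bar>)"
        using assms(1,3) is_cnn_extensional[OF f] is_cnn_extensional[OF fs]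
        by (intro mdist_tensor_metric)
      also have "\<dots> < e / 2"
        using n[OF _ that] ne by (subst Max_less_iff) (auto simp: dist_real_def abs_minus_commute)
      finally have "?m (f x) (fs n x) < e / 2" .
      then show ?thesis
        using gf[OF that] mdist_triangle[of "g x" "tensor_metric c' d" "f x" "fs n x"] gx[OF that]
          is_cnn_extensional[OF f, of x] is_cnn_extensional[OF fs, of n x]
        by (simp add: mspace_tensor_metric)
    qed
    then show ?thesis using fs by (auto simp: cnn_def)
  qed
  with g show "g \<in> cnn_closure \<rho> d k l c c' K"
    using cnn_closure_iff[OF K restrict_cnn_in_CK[OF assms(1-3) \<rho> K]] by auto
qed

section \<open>The normalised polynomial and the choice of the activation\<close>

lemma real_polynomial_function_imp_poly:
  assumes "real_polynomial_function p"
  obtains P :: "real poly" where "p = poly P"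
proof -
  obtain a n where p: "p = (\<lambda>x. \<Sum>i\<le>n. a i * x ^ i)"
    using assms by (auto simp: real_polynomial_function_iff_sum)
  have "p = poly (\<Sum>i\<le>n. monom (a i) i)"
    by (auto simp: p poly_sum poly_monom)
  then show ?thesis by (rule that)
qed

theorem lemma17:
  fixes p :: "real \<Rightarrow> real"
  assumes "real_polynomial_function p"
    and "\<not> (\<exists>a b. \<forall>x. p x = a * x + b)"
  shows "\<exists>\<sigma>. real_analytic \<sigma> \<and> \<not> real_polynomial_function \<sigma> \<and>
    (\<forall>d c c' w k K. 1 \<le> d \<longrightarrow> 1 \<le> c \<longrightarrow> 1 \<le> c' \<longrightarrow> 1 \<le> w \<longrightarrow>
       compactin (mtopology_of (tensor_metric c d)) K \<longrightarrow>
       cnn_closure \<sigma> d k w c c' K \<subseteq> cnn_closure p d k w c c' K)"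
proof -
  obtain P where p: "p = poly P" using assms(1) by (rule real_polynomial_function_imp_poly)
  have deg_P: "2 \<le> degree P"
  proof (rule ccontr)
    assume "\<not> 2 \<le> degree P"
    obtain b R where P: "P = pCons b R" by (rule pCons_cases)
    have "degree R = 0" using \<open>\<not> 2 \<le> degree P\<close> by (simp add: P split: if_splits)
    then obtain a where "R = [:a:]" by (rule degree_eq_zeroE)
    with P have P: "P = [:b, a:]" by simp
    then have "p x = a * x + b" for x by (simp add: p P)
    with assms(2) show False by blast
  qed
  then have "pderiv P \<noteq> 0" by (simp add: pderiv_eq_0_iff)
  then obtain x\<^sub>0 where x0: "poly (pderiv P) x\<^sub>0 \<noteq> 0" using poly_all_0_iff_0 by blast
  \<comment> \<open>By the chain rule this gives \<open>Q\<close> the derivative 2 at 0, as the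
    Poincare construction requires.\<close>
  define s where "s = 2 / poly (pderiv P) x\<^sub>0"
  have s: "s \<noteq> 0" "s * poly (pderiv P) x\<^sub>0 = 2" using x0 by (auto simp: s_def)
  define Q where "Q = pcompose P [:x\<^sub>0, s:] - [:p x\<^sub>0:]"
  have Q: "poly Q x = p (x\<^sub>0 + s * x) - p x\<^sub>0" for x
    by (simp add: Q_def p poly_pcompose mult.commute)
  have "degree (pcompose P [:x\<^sub>0, s:]) = degree P" using s by (simp add: degree_pcompose)
  then have deg_Q: "degree Q = degree P"
    unfolding Q_def diff_conv_add_uminus using deg_P by (subst degree_add_eq_left) auto
  have Q0: "coeff Q 0 = 0" using Q[of 0] by (simp add: poly_0_coeff_0)
  have "poly (pderiv Q) 0 = 2"
    using s by (simp add: Q_def pderiv_diff pderiv_pcompose poly_pcompose pderiv_pCons mult.commute)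
  then have Q1: "coeff Q 1 = 2" by (simp add: poly_0_coeff_0 coeff_pderiv)

  define F where "F = map_poly complex_of_real Q"
  have F: "coeff F 0 = 0" "coeff F 1 = 2" using Q0 Q1 by (simp_all add: F_def coeff_map_poly)
  obtain \<Phi> where hol: "\<Phi> holomorphic_on UNIV"
    and lim: "\<And>R. uniform_limit (cball 0 R) (\<lambda>n z. (poly F ^^ n) (z / 2 ^ n)) \<Phi> sequentially"
    and fe: "\<And>z. \<Phi> (2 * z) = poly F (\<Phi> z)" and \<Phi>0: "\<Phi> 0 = 0"
    and ne: "\<exists>x::real. \<Phi> (of_real x) \<noteq> 0"
    by (rule Poincare_function[OF F]) blast
  define g where "g n x = (poly Q ^^ n) (x / 2 ^ n)" for n x
  have F_of_real: "poly F (of_real x) = of_real (poly Q x)" for x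
    unfolding F_def by (induction Q) (auto simp: map_poly_pCons)
  have iter: "(poly F ^^ n) (of_real x) = of_real ((poly Q ^^ n) x)" for n x
    by (induction n) (auto simp: F_of_real)
  have iter': "(poly F ^^ n) (of_real x / 2 ^ n) = of_real (g n x)" for n x
    using iter[of n "x / 2 ^ n"] by (simp add: g_def)
  \<comment> \<open>The iterates are real at real points, hence so is the limit, and
    \<open>Re\<close> loses nothing; the fact \<open>real\<close> records this.\<close>
  define \<phi> where "\<phi> x = Re (\<Phi> (of_real x))" for x
  have lim_Re: "uniform_limit (cball 0 R) g \<phi> sequentially" for R
  proof -
    have "uniform_limit (cball 0 R) (\<lambda>n x. (poly F ^^ n) (of_real x / 2 ^ n))
        (\<lambda>x. \<Phi> (of_real x)) sequentially"
      by (rule uniform_limit_compose'[OF lim[of R]]) auto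
    then show ?thesis
      using bounded_linear.uniform_limit[OF bounded_linear_Re] unfolding iter' \<phi>_def by fastforce
  qed
  have real: "\<Phi> (of_real x) = of_real (\<phi> x)" for x
  proof (rule LIMSEQ_unique)
    show "(\<lambda>n. complex_of_real (g n x)) \<longlonglongrightarrow> \<Phi> (of_real x)"
      using tendsto_uniform_limitI[OF lim[of "\<bar>x\<bar>"], of "of_real x"] by (simp add: iter')
    show "(\<lambda>n. complex_of_real (g n x)) \<longlonglongrightarrow> of_real (\<phi> x)"
      using tendsto_uniform_limitI[OF lim_Re[of "\<bar>x\<bar>"], of x] by (intro tendsto_of_real) auto
  qed
  have \<phi>_fe: "\<phi> (2 * x) = poly Q (\<phi> x)" for x
  proof -
    have "complex_of_real (\<phi> (2 * x)) = of_real (poly Q (\<phi> x))"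
      using fe[of "of_real x"] real[of "2 * x"] by (simp add: real F_of_real)
    then show ?thesis by (simp only: of_real_eq_iff)
  qed

  \<comment> \<open>By the functional equation this is \<open>p (x\<^sub>0 + s * \<phi> x)\<close>.
    The present form is a shift of a rescaled \<open>\<phi>\<close>, so analyticity and
    non-polynomiality reduce to those of \<open>\<phi>\<close>.\<close>
  define \<sigma> where "\<sigma> x = \<phi> (2 * x) + p x\<^sub>0" for x
  have analytic: "real_analytic \<sigma>"
  proof (rule real_analytic_of_holomorphic)
    show "(\<lambda>z. (\<Phi> \<circ> (*) 2) z + of_real (p x\<^sub>0)) holomorphic_on UNIV"
      by (intro holomorphic_intros holomorphic_on_compose holomorphic_on_subset[OF hol]) auto
    show "(\<Phi> \<circ> (*) 2) (of_real x) + of_real (p x\<^sub>0) = of_real (\<sigma> x)" for x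
      using real[of "2 * x"] by (simp add: \<sigma>_def)
  qed
  have cont: "continuous_on UNIV \<sigma>"
    unfolding \<sigma>_def \<phi>_def
    by (intro continuous_intros continuous_on_compose2[OF holomorphic_on_imp_continuous_on[OF hol]]) auto
  have not_poly: "\<not> real_polynomial_function \<sigma>"
  proof
    assume "real_polynomial_function \<sigma>"
    then obtain S where S: "\<sigma> = poly S" by (rule real_polynomial_function_imp_poly)
    define R where "R = pcompose S [:0, 1 / 2:] - [:p x\<^sub>0:]"
    have R: "\<phi> x = poly R x" for x
    proof -
      have "\<phi> x = \<sigma> (x / 2) - p x\<^sub>0" by (simp add: \<sigma>_def)
      then show ?thesis by (simp add: R_def S poly_pcompose)
    qed
    \<comment> \<open>In \<open>R (2 x) = Q (R x)\<close> only the right side multiplies the degree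
      by \<open>degree P \<ge> 2\<close>. Hence \<open>R\<close> is constant, and the value 0 at 0
      makes it vanish.\<close>
    have "poly (pcompose R [:0, 2:]) = poly (pcompose Q R)"
      using \<phi>_fe by (auto simp: R poly_pcompose mult.commute)
    then have "degree (pcompose R [:0, 2:]) = degree (pcompose Q R)"
      by (simp add: poly_eq_poly_eq_iff)
    then have "degree R = degree P * degree R" by (simp add: degree_pcompose deg_Q)
    then have "degree R = 0" using deg_P by auto
    moreover have "poly R 0 = 0" using \<Phi>0 R[of 0] by (simp add: \<phi>_def)
    ultimately have "R = 0" by (auto elim!: degree_eq_zeroE)
    then have "\<phi> x = 0" for x by (simp add: R)
    with ne show False by (simp add: real)
  qed

  \<comment> \<open>The iterate \<open>g n\<close> is carried back to the coordinate of
    \<open>p\<close>.\<close>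
  define h where "h n x = s * g n x + x\<^sub>0" for n x
  have iterate: "affine_iterate p (\<lambda>x. s * (poly Q ^^ n) (c * x) + x\<^sub>0)" for n c
  proof (induction n)
    case 0
    show ?case using affine_iterate.affine[of p "s * c" x\<^sub>0] by (simp add: mult.assoc)
  next
    case (Suc n)
    \<comment> \<open>As \<open>poly Q y\<close> is
      \<open>p (x\<^sub>0 + s * y) - p x\<^sub>0\<close>, the affine map around \<open>p\<close> has
      slope \<open>s\<close> and constant term \<open>x\<^sub>0 - s * p x\<^sub>0\<close>.\<close>
    from affine_iterate.step[OF this, of s "x\<^sub>0 - s * p x\<^sub>0"] show ?case
      by (simp add: Q algebra_simps)
  qed
  have h: "affine_iterate p (h n)" for n
    using iterate[of n "1 / 2 ^ n"] unfolding h_def g_def by simp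
  \<comment> \<open>One application of \<open>p\<close> raises the index to \<open>Suc n\<close>;
    the argument \<open>2 * x\<close> makes up for the scaling by \<open>2 ^ Suc n\<close>
    there.\<close>
  have ph: "p (h n x) = g (Suc n) (2 * x) + p x\<^sub>0" for n x
    by (simp add: h_def g_def Q add.commute)
  have lim_ph: "uniform_limit (cball 0 R) (\<lambda>n x. p (h n x)) \<sigma> sequentially" for R
  proof -
    have "uniform_limit (cball 0 R) (\<lambda>n x. g n (2 * x)) (\<lambda>x. \<phi> (2 * x)) sequentially"
      by (rule uniform_limit_compose'[OF lim_Re[of "2 * R"]]) auto
    then have "uniform_limit (cball 0 R) (\<lambda>n x. g (Suc n) (2 * x)) (\<lambda>x. \<phi> (2 * x)) sequentially"
      by (rule filterlim_sequentially_Suc[THEN iffD2])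
    then show ?thesis
      unfolding ph \<sigma>_def by (intro uniform_limit_intros)
  qed
  have "continuous_on UNIV p" unfolding p by (intro continuous_intros)
  with analytic not_poly show ?thesis
    using cnn_closure_subset[OF _ _ _ cont _ h lim_ph] by blast
qed

end
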